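(* For all positive integers $n$ and $k$, the number of permutations in $s^{-1}(\mathrm{Av}_n(231,312))$ that have exactly $k-1$ descents is $\mathrm{BoNa}(n,k)$.
   Context: A binary plane tree is a rooted plane tree on unlabeled vertices in which every non-leaf vertex has one or two children, and every child is a left child or a right child, even if it is the only child of its parent. A 0-1-tree is a binary plane tree in which every vertex that has two children is labeled 0 or 1 (no other vertex is labeled). A right edge is an edge connecting a vertex to its right child. For $n\ge 1$, the Boolean-Narayana number $\mathrm{BoNa}(n,k)$ is the number of 0-1-trees on $n$ vertices that have exactly $k-1$ right edges. The stack sorting operation $s$ is defined recursively on finite strings of distinct positive integers (permutations and their substrings): $s$ of the empty string is empty, $s$ of a one-element string is itself, and if $p=LmR$ where $m$ is the maximum entry of $p$, $L$ is the (possibly empty) substring of entries to the left of $m$ and $R$ the (possibly empty) substring of entries to the right of $m$, then $s(p)=s(L)\,s(R)\,m$. A permutation $p=p_1p_2\cdots p_n$ contains the pattern $q=q_1\cdots q_k$ if there are indices $i_1<\cdots<i_k$ such that $p_{i_a}<p_{i_b}$ if and only if $q_a<q_b$; otherwise $p$ avoids $q$. $\mathrm{Av}_n(q,q')$ is the set of permutations of length $n$ that avoid both $q$ and $q'$, and $s^{-1}(\mathrm{Av}_n(q,q'))$ is the set of permutations $p$ of length $n$ such that $s(p)\in \mathrm{Av}_n(q,q')$. An index $i$ with $1\le i\le n-1$ is a descent of $p$ if $p_i>p_{i+1}$. *)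

theory Defs
  imports "HOL-Combinatorics.Multiset_Permutations"
begin

section \<open>0-1-trees\<close>

datatype label = Zero | One

text \<open>
  Every tree has at least its root vertex; the constructor records which children the root has,
  and only a root with two children carries a label. In particular an only child is either a
  left child or a right child.
\<close>

datatype zo_tree =
    Leaf
  | Left_Only zo_tree
  | Right_Only zo_tree
  | Both label zo_tree zo_tree

primrec vertices :: "zo_tree \<Rightarrow> nat" where
  "vertices Leaf = 1"
| "vertices (Left_Only l) = 1 + vertices l"
| "vertices (Right_Only r) = 1 + vertices r"
| "vertices (Both c l r) = 1 + vertices l + vertices r"

primrec right_edges :: "zo_tree \<Rightarrow> nat" where
  "right_edges Leaf = 0"
| "right_edges (Left_Only l) = right_edges l"
| "right_edges (Right_Only r) = 1 + right_edges r"
| "right_edges (Both c l r) = 1 + right_edges l + right_edges r"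

text \<open>Meaningful for \<open>n \<ge> 1\<close> and \<open>k \<ge> 1\<close> only, because of the truncated subtraction.\<close>

definition BoNa :: "nat \<Rightarrow> nat \<Rightarrow> nat" where
  "BoNa n k = card {t. vertices t = n \<and> right_edges t = k - 1}"

lemma vertices_pos: "vertices t > 0"
  by (cases t) auto

lemma finite_label: "finite (UNIV :: label set)"
proof -
  have "UNIV = {Zero, One}" by (auto intro: label.exhaust)
  then show ?thesis by (metis finite.emptyI finite.insertI)
qed

text \<open>The cardinality in \<open>BoNa\<close> is that of a finite set.\<close>

lemma finite_trees: "finite {t. vertices t \<le> n}"
proof (induction n)
  case 0
  have "{t. vertices t \<le> 0} = {}" using vertices_pos by (metis (mono_tags, lifting) Collect_empty_eq le_zero_eq less_irrefl)
  then show ?case by (metis finite.emptyI)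
next
  case (Suc n)
  let ?T = "{t. vertices t \<le> n}"
  have "{t. vertices t \<le> Suc n} \<subseteq>
    {Leaf} \<union> Left_Only ` ?T \<union> Right_Only ` ?T \<union> (\<lambda>(c, l, r). Both c l r) ` (UNIV \<times> ?T \<times> ?T)"
  proof
    fix t assume t: "t \<in> {t. vertices t \<le> Suc n}"
    show "t \<in> {Leaf} \<union> Left_Only ` ?T \<union> Right_Only ` ?T \<union> (\<lambda>(c, l, r). Both c l r) ` (UNIV \<times> ?T \<times> ?T)"
      using t by (cases t) (auto simp: image_iff)
  qed
  moreover have "finite ({Leaf} \<union> Left_Only ` ?T \<union> Right_Only ` ?T
      \<union> (\<lambda>(c, l, r). Both c l r) ` (UNIV \<times> ?T \<times> ?T))"
    using Suc.IH finite_label by (intro finite_UnI finite_imageI finite_cartesian_product) auto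
  ultimately show ?case by (rule finite_subset)
qed

section \<open>Stack sorting\<close>

text \<open>
  With \<open>m\<close> the maximum of \<open>p = L m R\<close>, the two list expressions below are \<open>L\<close> and \<open>R\<close>. The
  function is intended for lists of distinct entries; otherwise the first occurrence of the
  maximum is used.
\<close>

function stack_sort :: "nat list \<Rightarrow> nat list" where
  "stack_sort [] = []"
| "p \<noteq> [] \<Longrightarrow> stack_sort p =
    stack_sort (takeWhile (\<lambda>x. x \<noteq> Max (set p)) p) @
    stack_sort (tl (dropWhile (\<lambda>x. x \<noteq> Max (set p)) p)) @ [Max (set p)]"
  by auto

termination
proof (relation "measure length")
  show "wf (measure length)" by simp
next
  fix p :: "nat list" assume p: "p \<noteq> []"
  then have m: "Max (set p) \<in> set p" by simp
  have "length (takeWhile (\<lambda>x. x \<noteq> Max (set p)) p) < length p"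
    using m by (metis (mono_tags, lifting) length_takeWhile_le order_le_less set_takeWhileD
        takeWhile_eq_take take_all_iff le_refl)
  then show "(takeWhile (\<lambda>x. x \<noteq> Max (set p)) p, p) \<in> measure length"
    by simp
  have "length (dropWhile (\<lambda>x. x \<noteq> Max (set p)) p) \<le> length p"
    by (rule length_dropWhile_le)
  then show "(tl (dropWhile (\<lambda>x. x \<noteq> Max (set p)) p), p) \<in> measure length"
    using p by (cases "dropWhile (\<lambda>x. x \<noteq> Max (set p)) p") auto
qed

lemma stack_sort_max_split:
  assumes "distinct (L @ m # R)" "\<And>x. x \<in> set L \<union> set R \<Longrightarrow> x < m"
  shows "stack_sort (L @ m # R) = stack_sort L @ stack_sort R @ [m]"
proof -
  have M: "Max (set (L @ m # R)) = m"
    using assms(2) by (intro Max_eqI) (auto intro: less_imp_le)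
  have "m \<notin> set L" using assms(1) by auto
  then have "takeWhile (\<lambda>x. x \<noteq> m) (L @ m # R) = L" "dropWhile (\<lambda>x. x \<noteq> m) (L @ m # R) = m # R"
    by (auto simp: takeWhile_append dropWhile_append)
  with M show ?thesis using stack_sort.simps(2)[of "L @ m # R"] by simp
qed

section \<open>Patterns and descents\<close>

text \<open>
  Permutations of length \<open>n\<close> are written in one-line notation, as the lists in
  \<open>permutations_of_set {1..n}\<close>. List positions count from 0.
\<close>

definition contains_pattern :: "nat list \<Rightarrow> nat list \<Rightarrow> bool" where
  "contains_pattern p q \<longleftrightarrow>
    (\<exists>i :: nat \<Rightarrow> nat. strict_mono_on {..<length q} i \<and> (\<forall>a<length q. i a < length p) \<and>
      (\<forall>a<length q. \<forall>b<length q. p ! i a < p ! i b \<longleftrightarrow> q ! a < q ! b))"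

definition Av :: "nat \<Rightarrow> nat list \<Rightarrow> nat list \<Rightarrow> nat list set" where
  "Av n q q' = {p \<in> permutations_of_set {1..n}. \<not> contains_pattern p q \<and> \<not> contains_pattern p q'}"

definition stack_sort_preimage :: "nat \<Rightarrow> nat list set \<Rightarrow> nat list set" where
  "stack_sort_preimage n A = {p \<in> permutations_of_set {1..n}. stack_sort p \<in> A}"

definition descents :: "nat list \<Rightarrow> nat" where
  "descents p = card {i. Suc i < length p \<and> p ! i > p ! Suc i}"

end

(* Write p = L m R with m the maximum, so that s(p) = s(L) s(R) m. A permutation avoids 231 and 312
   iff it is a direct sum of decreasing layers, and a final maximum is irrelevant for this. If L and
   R are nonempty, then for s(L) s(R) to be layered both factors must be layered, and since s(L) ends
   with its maximum a, there are exactly two ways to interleave their entries: either all entries of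
   L are below all entries of R, or a alone is moved up so as to prolong the first layer of s(R).
   This binary choice is the label of a vertex with two children; the left and right subtrees encode
   L and R, and right edges correspond to descents, since m starts a descent iff R is nonempty. *)

theory Submission
  imports Defs "HOL-Library.Sublist"
begin

section \<open>Avoidance of 231 and 312 in terms of subsequences\<close>

text \<open>Of the two excluded configurations, the first is 231 and the second is 312. Speaking of
  entries instead of positions suits words over arbitrary sets of values and lets concatenations be
  analysed by splitting subsequences.\<close>

definition layered :: "nat list \<Rightarrow> bool" where
  "layered w \<longleftrightarrow> (\<forall>x y z. subseq [x, y, z] w \<longrightarrow> \<not> (z < x \<and> x < y) \<and> \<not> (y < z \<and> z < x))"

lemma subseq_Cons_iff_append:
  "subseq (x # xs) w \<longleftrightarrow> (\<exists>us vs. w = us @ x # vs \<and> subseq xs vs)"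
proof
  show "subseq (x # xs) w \<Longrightarrow> \<exists>us vs. w = us @ x # vs \<and> subseq xs vs"
    using list_emb_ConsD[of "(=)" x xs w] by blast
qed (auto intro: list_emb_append2)

lemma subseq_Cons_iff_nth:
  "subseq (x # xs) w \<longleftrightarrow> (\<exists>i<length w. w ! i = x \<and> subseq xs (drop (Suc i) w))"
proof
  assume "subseq (x # xs) w"
  then obtain us vs where w: "w = us @ x # vs" "subseq xs vs"
    by (auto simp: subseq_Cons_iff_append)
  show "\<exists>i<length w. w ! i = x \<and> subseq xs (drop (Suc i) w)"
    by (rule exI[of _ "length us"]) (use w in auto)
next
  assume "\<exists>i<length w. w ! i = x \<and> subseq xs (drop (Suc i) w)"
  then show "subseq (x # xs) w"
    by (metis id_take_nth_drop subseq_Cons_iff_append)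
qed

lemma subseq_triple_iff_nth:
  "subseq [x, y, z] w \<longleftrightarrow>
    (\<exists>i j k. i < j \<and> j < k \<and> k < length w \<and> w ! i = x \<and> w ! j = y \<and> w ! k = z)"
    (is "?l \<longleftrightarrow> ?r")
proof
  assume ?l
  then obtain i j k where *: "i < length w" "w ! i = x" "j < length w - Suc i" "w ! (Suc i + j) = y"
      "k < length w - Suc (Suc i + j)" "w ! (Suc (Suc i + j) + k) = z"
    by (auto simp: subseq_Cons_iff_nth ac_simps)
  show ?r
    by (rule exI[of _ i], rule exI[of _ "Suc i + j"], rule exI[of _ "Suc (Suc i + j) + k"])
       (use * in auto)
next
  assume ?r
  then obtain i j k where *: "i < j" "j < k" "k < length w" "w ! i = x" "w ! j = y" "w ! k = z"
    by blast
  have "subseq [z] (drop (Suc j) w)"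
    unfolding subseq_Cons_iff_nth by (rule exI[of _ "k - Suc j"]) (use * in auto)
  then have "subseq [z] (drop (Suc (j - Suc i)) (drop (Suc i) w))"
    using * by simp
  then have "subseq [y, z] (drop (Suc i) w)"
    unfolding subseq_Cons_iff_nth[of y "[z]"] by (intro exI[of _ "j - Suc i"]) (use * in auto)
  then show ?l
    unfolding subseq_Cons_iff_nth[of x "[y, z]"] by (intro exI[of _ i]) (use * in auto)
qed

text \<open>An increasing map on three indices is the same as a subsequence of length three, and the
  six comparisons between different positions are all that the order isomorphism demands.\<close>

lemma contains_pattern_triple:
  "contains_pattern w [a, b, c] \<longleftrightarrow>
    (\<exists>x y z. subseq [x, y, z] w \<and> (x < y \<longleftrightarrow> a < b) \<and> (y < x \<longleftrightarrow> b < a) \<and> (x < z \<longleftrightarrow> a < c) \<and>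
      (z < x \<longleftrightarrow> c < a) \<and> (y < z \<longleftrightarrow> b < c) \<and> (z < y \<longleftrightarrow> c < b))" (is "?l \<longleftrightarrow> ?r")
proof
  assume ?l
  then obtain i :: "nat \<Rightarrow> nat" where i: "strict_mono_on {..<3} i" "\<And>a. a < 3 \<Longrightarrow> i a < length w"
    "\<And>u v. u < 3 \<Longrightarrow> v < 3 \<Longrightarrow> w ! i u < w ! i v \<longleftrightarrow> [a, b, c] ! u < [a, b, c] ! v"
    unfolding contains_pattern_def by (auto simp: numeral_3_eq_3)
  have "i 0 < i 1" "i 1 < i 2" "i 2 < length w"
    using i(1,2) by (auto simp: strict_mono_on_def)
  then have "subseq [w ! i 0, w ! i 1, w ! i 2] w"
    unfolding subseq_triple_iff_nth by blast
  then show ?r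
    using i(3)[of 0 1] i(3)[of 1 0] i(3)[of 0 2] i(3)[of 2 0] i(3)[of 1 2] i(3)[of 2 1]
    by (intro exI[of _ "w ! i 0"] exI[of _ "w ! i 1"] exI[of _ "w ! i 2"]) simp
next
  assume ?r
  then obtain i j k where *: "i < j" "j < k" "k < length w"
    "w ! i < w ! j \<longleftrightarrow> a < b" "w ! j < w ! i \<longleftrightarrow> b < a" "w ! i < w ! k \<longleftrightarrow> a < c"
    "w ! k < w ! i \<longleftrightarrow> c < a" "w ! j < w ! k \<longleftrightarrow> b < c" "w ! k < w ! j \<longleftrightarrow> c < b"
    by (auto simp: subseq_triple_iff_nth)
  show ?l
    unfolding contains_pattern_def
    by (rule exI[of _ "\<lambda>u. if u = 0 then i else if u = 1 then j else k"])
       (use * in \<open>auto simp: strict_mono_on_def less_Suc_eq numeral_3_eq_3\<close>)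
qed

lemma layered_iff_avoids:
  "layered w \<longleftrightarrow> \<not> contains_pattern w [2, 3, 1] \<and> \<not> contains_pattern w [3, 1, 2]"
proof -
  have "contains_pattern w [2, 3, 1] \<longleftrightarrow> (\<exists>x y z. subseq [x, y, z] w \<and> z < x \<and> x < y)"
    unfolding contains_pattern_triple by (intro iff_exI) auto
  moreover have "contains_pattern w [3, 1, 2] \<longleftrightarrow> (\<exists>x y z. subseq [x, y, z] w \<and> y < z \<and> z < x)"
    unfolding contains_pattern_triple by (intro iff_exI) auto
  ultimately show ?thesis
    unfolding layered_def by blast
qed

lemma layered_single [simp]: "layered [x]"
  unfolding layered_def by (auto simp: subseq_Cons_iff_append)

section \<open>Layered words under concatenation\<close>

text \<open>Used with \<open>ex_append_eq_Nil\<close> as a rewrite system that turns a cut of an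
  explicit short list, as produced by \<open>subseq_append_iff\<close>, into a finite
  disjunction.\<close>

lemma ex_append_eq_Cons:
  "(\<exists>us vs. x # xs = us @ vs \<and> P us vs) \<longleftrightarrow> P [] (x # xs) \<or> (\<exists>us vs. xs = us @ vs \<and> P (x # us) vs)"
  unfolding Cons_eq_append_conv by blast

lemma ex_append_eq_Nil: "(\<exists>us vs. [] = us @ vs \<and> P us vs) \<longleftrightarrow> P [] []"
  by simp

lemma subseq_pair_append:
  "subseq [x, y] (u @ v) \<longleftrightarrow> subseq [x, y] u \<or> x \<in> set u \<and> y \<in> set v \<or> subseq [x, y] v"
  unfolding subseq_append_iff ex_append_eq_Cons ex_append_eq_Nil subseq_singleton_left by auto

lemma subseq_triple_append:
  "subseq [x, y, z] (u @ v) \<longleftrightarrow> subseq [x, y, z] u \<or> subseq [x, y] u \<and> z \<in> set v \<or>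
    x \<in> set u \<and> subseq [y, z] v \<or> subseq [x, y, z] v"
  unfolding subseq_append_iff ex_append_eq_Cons ex_append_eq_Nil subseq_singleton_left by auto

lemma subseq_set: "subseq xs w \<Longrightarrow> x \<in> set xs \<Longrightarrow> x \<in> set w"
  by (auto simp: subseq_conv_nths dest: in_set_nthsD)

lemma subseq_pair_distinct: "subseq [x, y] w \<Longrightarrow> distinct w \<Longrightarrow> x \<noteq> y"
  by (metis distinct_length_2_or_more distinct_nthsI subseq_conv_nths)

lemma subseq_pair_snoc:
  assumes "subseq [x, y] (u @ [a])"
  shows "x \<in> set u"
  using assms unfolding subseq_pair_append by (auto dest: subseq_set split: if_splits)

text \<open>Neither 231 nor 312 ends with its largest entry, while a final maximum can only take the
  last place of an occurrence.\<close>

lemma layered_snoc_iff: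
  assumes "\<And>x. x \<in> set w \<Longrightarrow> x < m"
  shows "layered (w @ [m]) \<longleftrightarrow> layered w"
proof -
  have "\<not> m < x" "\<not> (y < m \<and> m < x)" if "subseq [x, y] w" for x y
    using assms[of x] subseq_set[OF that, of x] by auto
  moreover have "subseq [x, y, z] (w @ [m]) \<longleftrightarrow> subseq [x, y, z] w \<or> subseq [x, y] w \<and> z = m" for x y z
    unfolding subseq_triple_append by (auto split: if_splits)
  ultimately show ?thesis
    unfolding layered_def by blast
qed

text \<open>Here \<open>u @ [a]\<close> stands for s(L), which ends with its maximum, and
  \<open>r\<close> for s(R). The two alternatives are the two ways to interleave the values:
  \<open>a\<close> below all of \<open>r\<close>, or \<open>a\<close> just above the first layer of
  \<open>r\<close>, which consists of the entries up to \<open>hd r\<close> because \<open>r\<close>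
  is layered.\<close>

lemma layered_append_iff:
  assumes dist: "distinct (u @ a # r)" and ua: "\<And>x. x \<in> set u \<Longrightarrow> x < a" and r: "r \<noteq> []"
  shows "layered (u @ a # r) \<longleftrightarrow> layered (u @ [a]) \<and> layered r \<and>
    ((\<forall>x\<in>insert a (set u). \<forall>y\<in>set r. x < y) \<or>
     (\<forall>x\<in>set u. \<forall>y\<in>set r. x < y) \<and> (\<forall>y\<in>set r. y < a \<longleftrightarrow> y \<le> hd r))" (is "?l \<longleftrightarrow> ?r")
proof -
  have split: "subseq [x, y, z] (u @ a # r) \<longleftrightarrow> subseq [x, y, z] (u @ [a]) \<or>
    subseq [x, y] (u @ [a]) \<and> z \<in> set r \<or> x \<in> set (u @ [a]) \<and> subseq [y, z] r \<or> subseq [x, y, z] r"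
    for x y z
    using subseq_triple_append[of x y z "u @ [a]" r] by simp
  obtain h w where hw: "r = h # w"
    using r by (cases r) auto
  show ?thesis
  proof
    assume l: ?l
    have lu: "layered (u @ [a])" and lr: "layered r"
      using l unfolding layered_def split by blast+
    have less: "x < y" if "x \<in> set u" "y \<in> set r" for x y
    proof -
      have "subseq [x, a] (u @ [a])"
        using that unfolding subseq_pair_append by simp
      \<comment> \<open>Otherwise \<open>x\<close>, \<open>a\<close>, \<open>y\<close> would form
        231.\<close>
      then have "\<not> (y < x \<and> x < a)"
        using l that unfolding layered_def split by blast
      then show ?thesis
        using ua[OF that(1)] dist that by (cases x y rule: linorder_cases) auto
    qed
    \<comment> \<open>The triple \<open>a\<close>, \<open>h\<close>, \<open>y\<close> must be
      neither 231 nor 312. If \<open>a < h\<close>, the first condition puts \<open>a\<close> below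
      all of \<open>r\<close>; if \<open>h < a\<close>, the second leaves no entry of
      \<open>r\<close> between \<open>h\<close> and \<open>a\<close>.\<close>
    have later: "\<not> (y < a \<and> a < h) \<and> \<not> (h < y \<and> y < a)" if "y \<in> set w" for y
    proof -
      have "subseq [h, y] r"
        using that hw by (simp add: subseq_singleton_left)
      then have "subseq [a, h, y] (u @ a # r)"
        unfolding split by auto
      then show ?thesis
        using l unfolding layered_def by blast
    qed
    have "a \<notin> set r"
      using dist by auto
    then have "(\<forall>y\<in>set r. a < y) \<or> (\<forall>y\<in>set r. y < a \<longleftrightarrow> y \<le> hd r)"
      using later hw by (cases "h < a") (force, force)
    then show ?r
      using lu lr less by blast
  next
    assume R: ?r
    have lu: "layered (u @ [a])" and lr: "layered r"
      using R by (fact conjunct1, fact conjunct1[OF conjunct2])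
    have "\<not> (z < x \<and> x < y) \<and> \<not> (y < z \<and> z < x)" if s: "subseq [x, y, z] (u @ a # r)" for x y z
      using s[unfolded split]
    proof (elim disjE conjE)
      assume "subseq [x, y] (u @ [a])" "z \<in> set r"
      then have "x \<in> set u" "z \<in> set r"
        using subseq_pair_snoc[of x y u a] by simp_all
      then have "x < z"
        using R by auto
      then show ?thesis by simp
    next
      assume x: "x \<in> set (u @ [a])" and yz: "subseq [y, z] r"
      have yzr: "y \<in> set r" "z \<in> set r" and ne: "y \<noteq> z"
        using subseq_set[OF yz] subseq_pair_distinct[OF yz] dist by auto
      show ?thesis
      proof (cases "x < y \<and> x < z")
        \<comment> \<open>No excluded pattern begins with its smallest entry, so only this case
          matters. Entries of \<open>u\<close> lie below all of \<open>r\<close>, hence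
          \<open>x\<close> is \<open>a\<close> and the second alternative holds.\<close>
        case False
        have "x = a \<and> (\<forall>y\<in>set r. y < a \<longleftrightarrow> y \<le> h)"
        proof -
          have "\<not> (\<forall>y\<in>set r. x < y)"
            using False yzr by blast
          moreover have "x \<in> insert a (set u)"
            using x by simp
          moreover have "hd r = h"
            using hw by simp
          ultimately show ?thesis
            using R by blast
        qed
        then have x: "x = a" and a: "\<forall>y\<in>set r. y < a \<longleftrightarrow> y \<le> h"
          by simp_all
        have "z \<in> set w"
          using yz hw by (auto simp: subseq_singleton_left dest: subseq_set split: if_splits)
        then have "z \<noteq> h"
          using dist hw by auto
        \<comment> \<open>Since no entry of \<open>r\<close> lies between \<open>h\<close> and
          \<open>a\<close>, replacing \<open>a\<close> by \<open>h\<close> keeps all comparisons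
          with \<open>y\<close> and \<open>z\<close>, and the triple moves into the layered word
          \<open>r\<close>. If \<open>y = h\<close>, the condition on \<open>a\<close> excludes both
          patterns directly.\<close>
        moreover have "subseq [h, y, z] r" if "y \<noteq> h"
          using that yz hw by (auto split: if_splits)
        then have "y \<noteq> h \<Longrightarrow> \<not> (z < h \<and> h < y) \<and> \<not> (y < z \<and> z < h)"
          using lr unfolding layered_def by blast
        ultimately show ?thesis
          using a x yzr by (metis le_neq_implies_less linorder_not_le order.asym)
      qed auto
    qed (use lu lr in \<open>unfold layered_def, blast+\<close>)
    then show ?l
      unfolding layered_def by blast
  qed
qed

section \<open>Splitting at the maximum, and basic facts on stack sorting\<close>

declare stack_sort.simps(2) [simp del]

lemma max_split:
  assumes "distinct p" "p \<noteq> []"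
  obtains L m R where "p = L @ m # R" "\<forall>x\<in>set L \<union> set R. x < (m :: nat)"
proof -
  have "Max (set p) \<in> set p"
    using assms by simp
  then obtain L R where LR: "p = L @ Max (set p) # R"
    by (meson split_list)
  have "x < Max (set p)" if "x \<in> set L \<union> set R" for x
  proof -
    have "x \<in> set p"
      by (subst LR) (use that in auto)
    then have "x \<le> Max (set p)"
      by simp
    moreover have "distinct (L @ Max (set p) # R)"
      using LR assms(1) by metis
    then have "x \<noteq> Max (set p)"
      using that by auto
    ultimately show ?thesis
      by simp
  qed
  then show thesis
    using that LR by blast
qed

text \<open>Induction along the recursion of \<open>stack_sort\<close>, with the maximum described
  by inequalities so that \<open>takeWhile\<close> and \<open>dropWhile\<close> stay out of later
  proofs.\<close>

lemma max_split_induct [consumes 1, case_names Nil split]: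
  fixes p :: "nat list"
  assumes "distinct p" and "P []"
    and "\<And>L m R. distinct (L @ m # R) \<Longrightarrow> \<forall>x\<in>set L \<union> set R. x < m \<Longrightarrow> P L \<Longrightarrow> P R \<Longrightarrow> P (L @ m # R)"
  shows "P p"
  using assms(1)
proof (induction p rule: length_induct)
  case (1 p)
  show ?case
  proof (cases "p = []")
    case False
    then obtain L m R where p: "p = L @ m # R" "\<forall>x\<in>set L \<union> set R. x < m"
      using "1.prems" max_split by blast
    moreover from p "1.prems" have "distinct L" "distinct R" "length L < length p" "length R < length p"
      by auto
    ultimately show ?thesis
      using 1 assms(3) by blast
  qed (use assms(2) in simp)
qed

lemma insert_greatest_eq:
  fixes m m' :: "'a :: linorder"
  assumes "insert m X = insert m' X'" "\<forall>x\<in>X. x < m" "\<forall>x\<in>X'. x < m'"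
  shows "m = m'" "X = X'"
proof -
  have "m \<in> insert m' X'" "m' \<in> insert m X"
    using assms(1) by blast+
  then have "m = m' \<or> m < m' \<and> m' < m"
    using assms(2,3) by blast
  then show m: "m = m'"
    by (blast dest: order.asym)
  have "m \<notin> X" "m' \<notin> X'"
    using assms(2,3) by blast+
  then show "X = X'"
    using assms(1) m insert_ident by metis
qed

text \<open>Comparing the underlying sets identifies the maxima; the maximum occurs only once in the
  word, so it fixes the cut.\<close>

lemma max_split_unique:
  assumes "L @ m # R = L' @ m' # R'" "\<forall>x\<in>set L \<union> set R. x < m" "\<forall>x\<in>set L' \<union> set R'. x < (m' :: nat)"
  shows "L = L'" "m = m'" "R = R'"
proof -
  have "insert m (set L \<union> set R) = insert m' (set L' \<union> set R')"
    using arg_cong[OF assms(1), of set] by simp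
  then show m: "m = m'"
    using assms(2,3) by (rule insert_greatest_eq)
  have "m \<notin> set L" "m \<notin> set R" "m \<notin> set L'" "m \<notin> set R'"
    using assms(2,3) m by auto
  then show "L = L'" "R = R'"
    using assms(1) m by (auto simp: append_Cons_eq_iff)
qed

lemma set_distinct_stack_sort:
  assumes "distinct p"
  shows "set (stack_sort p) = set p \<and> distinct (stack_sort p)"
  using assms
proof (induction p rule: max_split_induct)
  case (split L m R)
  then show ?case
    using stack_sort_max_split[of L m R] by auto
qed simp

lemmas set_stack_sort [simp] = conjunct1[OF set_distinct_stack_sort]
lemmas distinct_stack_sort [simp] = conjunct2[OF set_distinct_stack_sort]

lemma stack_sort_snoc:
  assumes "distinct L" "\<forall>x\<in>set L. x < m"
  shows "stack_sort (L @ [m]) = stack_sort L @ [m]"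
  using assms stack_sort_max_split[of L m "[]"] by auto

lemma stack_sort_Cons:
  assumes "distinct R" "\<forall>x\<in>set R. x < m"
  shows "stack_sort (m # R) = stack_sort R @ [m]"
  using assms stack_sort_max_split[of "[]" m R] by auto

lemma stack_sort_eq_Nil_iff:
  assumes "distinct p"
  shows "stack_sort p = [] \<longleftrightarrow> p = []"
  using assms set_empty[of "stack_sort p"] by simp

lemma hd_stack_sort_in:
  assumes "distinct p" "p \<noteq> []"
  shows "hd (stack_sort p) \<in> set p"
  using assms hd_in_set[of "stack_sort p"] by (simp add: stack_sort_eq_Nil_iff)

text \<open>Supplies the shape \<open>u @ [a]\<close> that \<open>layered_append_iff\<close> expects
  of its left factor.\<close>

lemma stack_sort_last_Max:
  assumes "distinct p" "p \<noteq> []"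
  obtains u where "stack_sort p = u @ [Max (set p)]" "\<forall>x\<in>set u. x < Max (set p)"
    "set u = set p - {Max (set p)}"
proof -
  obtain L m R where p: "p = L @ m # R" "\<forall>x\<in>set L \<union> set R. x < m"
    using assms max_split by blast
  have "Max (set p) = m"
    using p by (intro Max_eqI) (auto intro: less_imp_le)
  moreover have "stack_sort p = (stack_sort L @ stack_sort R) @ [m]"
    using p assms stack_sort_max_split[of L m R] by auto
  moreover have "set (stack_sort L @ stack_sort R) = set p - {m}"
    using p assms by auto
  ultimately show thesis
    using that[of "stack_sort L @ stack_sort R"] p assms by auto
qed

section \<open>The two ways of joining the parts left and right of the maximum\<close>

text \<open>In the case of \<open>One\<close>, the condition on \<open>hd (stack_sort R)\<close> says that \<open>Max (set L)\<close> lies just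
  above the entries of the first layer of \<open>s(R)\<close>, as that layer starts with its maximum.\<close>

primrec joins :: "label \<Rightarrow> nat list \<Rightarrow> nat list \<Rightarrow> bool" where
  "joins Zero L R \<longleftrightarrow> (\<forall>x\<in>set L. \<forall>y\<in>set R. x < y)"
| "joins One L R \<longleftrightarrow> Max (set L) \<notin> set R \<and> (\<forall>x\<in>set L - {Max (set L)}. \<forall>y\<in>set R. x < y) \<and>
    (\<forall>y\<in>set R. y < Max (set L) \<longleftrightarrow> y \<le> hd (stack_sort R))"

lemma ex_label_iff: "(\<exists>c. P c) \<longleftrightarrow> P Zero \<or> P One"
  by (metis label.exhaust)

lemma joins_disjoint: "joins c L R \<Longrightarrow> set L \<inter> set R = {}"
  by (cases c) auto

text \<open>The entry \<open>hd (stack_sort R)\<close> tells the labels apart: under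
  \<open>One\<close> it lies below \<open>Max (set L)\<close>, under \<open>Zero\<close> above
  it.\<close>

lemma joins_label_unique:
  assumes "joins c L R" "joins c' L R" "distinct R" "L \<noteq> []" "R \<noteq> []"
  shows "c = c'"
proof -
  have False if "joins Zero L R" "joins One L R"
  proof -
    have "Max (set L) \<in> set L"
      using assms by simp
    then show False
      using that hd_stack_sort_in[OF assms(3,5)] by force
  qed
  then show ?thesis
    using assms by (metis label.exhaust)
qed

text \<open>The alternatives of \<open>layered_append_iff\<close>, taken with \<open>a\<close> as
  the maximum of \<open>L\<close>, are exactly the two labels.\<close>

lemma layered_stack_sort_append_iff:
  assumes "distinct (L @ R)" "L \<noteq> []" "R \<noteq> []"
  shows "layered (stack_sort L @ stack_sort R) \<longleftrightarrow>
    layered (stack_sort L) \<and> layered (stack_sort R) \<and> (\<exists>c. joins c L R)"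
proof -
  have dL: "distinct L" and dR: "distinct R" and disj: "set L \<inter> set R = {}"
    using assms by auto
  obtain u where u: "stack_sort L = u @ [Max (set L)]" "\<forall>x\<in>set u. x < Max (set L)"
    "set u = set L - {Max (set L)}"
    using stack_sort_last_Max[OF dL assms(2)] .
  have max: "Max (set L) \<in> set L"
    using assms(2) by simp
  then have notin: "Max (set L) \<notin> set R"
    using disj by blast
  have L: "insert (Max (set L)) (set u) = set L"
    using u(3) max by blast
  have "distinct (stack_sort L @ stack_sort R)"
    using dL dR disj by simp
  then have "distinct (u @ Max (set L) # stack_sort R)"
    using u(1) by simp
  moreover have "stack_sort R \<noteq> []"
    using stack_sort_eq_Nil_iff dR assms(3) by simp
  ultimately show ?thesis
    using layered_append_iff[of u "Max (set L)" "stack_sort R"] u(1,2) dR notin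
    unfolding L unfolding u(3) ex_label_iff by simp
qed

section \<open>Descents around the maximum\<close>

lemma descents_Cons_Cons:
  "descents (x # y # zs) = (if y < x then 1 else 0) + descents (y # zs)"
proof -
  have "{i. Suc i < length (x # y # zs) \<and> (x # y # zs) ! i > (x # y # zs) ! Suc i} =
    (if y < x then {0} else {}) \<union> Suc ` {i. Suc i < length (y # zs) \<and> (y # zs) ! i > (y # zs) ! Suc i}"
    (is "?A = ?B \<union> Suc ` ?C")
  proof (rule set_eqI)
    show "i \<in> ?A \<longleftrightarrow> i \<in> ?B \<union> Suc ` ?C" for i
      by (cases i) (auto simp: image_iff)
  qed
  moreover have "finite ?C"
    by (rule finite_subset[of _ "{..<length (y # zs)}"]) auto
  then have "card (?B \<union> Suc ` ?C) = card ?B + card ?C"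
    by (subst card_Un_disjoint) (auto simp: card_image)
  ultimately show ?thesis
    unfolding descents_def by simp
qed

lemma descents_single [simp]: "descents [x] = 0"
  by (simp add: descents_def)

text \<open>The step from the last entry of \<open>L\<close> up to \<open>m\<close> is an ascent, so
  cutting there loses no descent.\<close>

lemma descents_append_max:
  assumes "\<forall>x\<in>set L. x < m"
  shows "descents (L @ m # R) = descents L + descents (m # R)"
  using assms
proof (induction L)
  case Nil
  then show ?case by (simp add: descents_def)
next
  case (Cons x L)
  then show ?case by (cases L) (auto simp: descents_Cons_Cons)
qed

lemma descents_max_Cons:
  assumes "\<forall>x\<in>set R. x < m" "R \<noteq> []"
  shows "descents (m # R) = Suc (descents R)"
  using assms by (cases R) (auto simp: descents_Cons_Cons)

section \<open>Encoding of words by trees\<close>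

text \<open>A relation on words over any set of values, so that \<open>L\<close> and
  \<open>R\<close> need no standardization before they are matched with subtrees. Existence and
  uniqueness are shown separately in each direction.\<close>

primrec encodes :: "zo_tree \<Rightarrow> nat list \<Rightarrow> bool" where
  "encodes Leaf p \<longleftrightarrow> (\<exists>m. p = [m])"
| "encodes (Left_Only l) p \<longleftrightarrow> (\<exists>L m. p = L @ [m] \<and> (\<forall>x\<in>set L. x < m) \<and> encodes l L)"
| "encodes (Right_Only r) p \<longleftrightarrow> (\<exists>m R. p = m # R \<and> (\<forall>x\<in>set R. x < m) \<and> encodes r R)"
| "encodes (Both c l r) p \<longleftrightarrow> (\<exists>L m R. p = L @ m # R \<and> (\<forall>x\<in>set L \<union> set R. x < m) \<and>
    encodes l L \<and> encodes r R \<and> joins c L R)"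

text \<open>All properties go through one induction because they feed each other: a nonempty right
  part accounts for the descent at \<open>m\<close>, and distinctness and nonemptiness are what the
  analysis of \<open>stack_sort\<close> at the maximum requires.\<close>

lemma encodes_properties:
  assumes "encodes t p"
  shows "p \<noteq> [] \<and> distinct p \<and> length p = vertices t \<and> descents p = right_edges t \<and>
    layered (stack_sort p)"
  using assms
proof (induction t arbitrary: p)
  case Leaf
  then show ?case using stack_sort_snoc[of "[]"] by auto
next
  case (Left_Only l)
  then obtain L m where p: "p = L @ [m]" "\<forall>x\<in>set L. x < m" "encodes l L"
    by auto
  with Left_Only.IH[of L] show ?case
    using layered_snoc_iff[of "stack_sort L" m] by (auto simp: descents_append_max stack_sort_snoc)
next
  case (Right_Only r)
  then obtain R m where p: "p = m # R" "\<forall>x\<in>set R. x < m" "encodes r R"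
    by auto
  with Right_Only.IH[of R] show ?case
    using layered_snoc_iff[of "stack_sort R" m] by (auto simp: descents_max_Cons stack_sort_Cons)
next
  case (Both c l r)
  then obtain L m R where p: "p = L @ m # R" "\<forall>x\<in>set L \<union> set R. x < m"
    "encodes l L" "encodes r R" "joins c L R"
    by auto
  have L: "L \<noteq> []" "distinct L" "length L = vertices l" "descents L = right_edges l"
      "layered (stack_sort L)"
    and R: "R \<noteq> []" "distinct R" "length R = vertices r" "descents R = right_edges r"
      "layered (stack_sort R)"
    using Both.IH p by blast+
  have d: "distinct (L @ m # R)"
    using p(2) L(2) R(2) joins_disjoint[OF p(5)] by auto
  then have "stack_sort p = (stack_sort L @ stack_sort R) @ [m]"
    using p stack_sort_max_split[of L m R] by auto
  moreover have "layered (stack_sort L @ stack_sort R)"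
    using layered_stack_sort_append_iff[of L R] d L R p(5) by auto
  then have "layered ((stack_sort L @ stack_sort R) @ [m])"
    using L R p(2) by (subst layered_snoc_iff) auto
  ultimately show ?case
    using p d L R by (simp add: descents_append_max descents_max_Cons)
qed

text \<open>Which of \<open>L\<close> and \<open>R\<close> are empty selects the constructor; if
  neither is, layeredness of s(L) s(R) supplies the label.\<close>

lemma ex_encodes:
  assumes "distinct p" "p \<noteq> []" "layered (stack_sort p)"
  shows "\<exists>t. encodes t p"
  using assms
proof (induction p rule: max_split_induct)
  case (split L m R)
  have d: "distinct L" "distinct R" "distinct (L @ R)"
    using split.hyps by auto
  have "stack_sort (L @ m # R) = (stack_sort L @ stack_sort R) @ [m]"
    using split.hyps stack_sort_max_split[of L m R] by auto
  then have lay: "layered (stack_sort L @ stack_sort R)"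
    using split.hyps split.prems d layered_snoc_iff[of "stack_sort L @ stack_sort R" m] by auto
  show ?case
  proof (cases "L = []")
    case True
    then show ?thesis
    proof (cases "R = []")
      case True
      then have "encodes Leaf (L @ m # R)"
        using \<open>L = []\<close> by simp
      then show ?thesis by blast
    next
      case False
      then obtain r where "encodes r R"
        using split.IH(2) lay \<open>L = []\<close> by auto
      then have "encodes (Right_Only r) (L @ m # R)"
        using \<open>L = []\<close> split.hyps by auto
      then show ?thesis by blast
    qed
  next
    case L: False
    show ?thesis
    proof (cases "R = []")
      case True
      then obtain l where "encodes l L"
        using split.IH(1) lay L by auto
      then have "encodes (Left_Only l) (L @ m # R)"
        using True split.hyps by auto
      then show ?thesis by blast
    next
      case False
      then have "layered (stack_sort L)" "layered (stack_sort R)" "\<exists>c. joins c L R"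
        using lay layered_stack_sort_append_iff[OF d(3) L False] by auto
      then obtain c l r where "joins c L R" "encodes l L" "encodes r R"
        using split.IH L False by blast
      then have "encodes (Both c l r) (L @ m # R)"
        using split.hyps by auto
      then show ?thesis by blast
    qed
  qed
qed simp

text \<open>The cut at the maximum is unique and encoded words are nonempty, so the emptiness of
  \<open>L\<close> and \<open>R\<close> determines the root of the tree.\<close>

lemma encodes_split:
  assumes "encodes t (L @ m # R)" "\<forall>x\<in>set L \<union> set R. x < m"
  obtains "L = []" "R = []" "t = Leaf"
  | l where "L \<noteq> []" "R = []" "t = Left_Only l" "encodes l L"
  | r where "L = []" "R \<noteq> []" "t = Right_Only r" "encodes r R"
  | c l r where "L \<noteq> []" "R \<noteq> []" "t = Both c l r" "encodes l L" "encodes r R" "joins c L R"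
proof (cases t)
  case Leaf
  then show thesis
    using assms that(1) by (auto simp: append_eq_Cons_conv)
next
  case (Left_Only l)
  then obtain L' m' where *: "L @ m # R = L' @ m' # []" "\<forall>x\<in>set L' \<union> set []. x < m'" "encodes l L'"
    using assms(1) by auto
  then show thesis
    using max_split_unique[OF *(1) assms(2) *(2)] that(2) Left_Only encodes_properties by metis
next
  case (Right_Only r)
  then obtain m' R' where *: "L @ m # R = [] @ m' # R'" "\<forall>x\<in>set [] \<union> set R'. x < m'" "encodes r R'"
    using assms(1) by auto
  then show thesis
    using max_split_unique[OF *(1) assms(2) *(2)] that(3) Right_Only encodes_properties by metis
next
  case (Both c l r)
  then obtain L' m' R' where *: "L @ m # R = L' @ m' # R'" "\<forall>x\<in>set L' \<union> set R'. x < m'"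
    "encodes l L'" "encodes r R'" "joins c L' R'"
    using assms(1) by auto
  then show thesis
    using max_split_unique[OF *(1) assms(2) *(2)] that(4) Both encodes_properties by metis
qed

lemma encodes_tree_unique:
  assumes "distinct p" "encodes t p" "encodes t' p"
  shows "t = t'"
  using assms
proof (induction p arbitrary: t t' rule: max_split_induct)
  case Nil
  then show ?case using encodes_properties by blast
next
  case (split L m R)
  have "distinct R"
    using split.hyps by simp
  then show ?case
    using split.IH joins_label_unique
    by (cases rule: encodes_split[OF split.prems(1) split.hyps(2)];
        cases rule: encodes_split[OF split.prems(2) split.hyps(2)]) blast+
qed

section \<open>The first layer of the sorted word\<close>

text \<open>The length of the first layer of \<open>s(p)\<close>, for any word \<open>p\<close> encoded by the tree.\<close>

primrec head_rank :: "zo_tree \<Rightarrow> nat" where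
  "head_rank Leaf = 1"
| "head_rank (Left_Only l) = head_rank l"
| "head_rank (Right_Only r) = head_rank r"
| "head_rank (Both c l r) = (if c = One \<and> l = Leaf then Suc (head_rank r) else head_rank l)"

lemma vertices_neq_0 [simp]: "vertices t \<noteq> 0"
  using vertices_pos[of t] by simp

text \<open>The first layer of s(p) is that of s(L), unless \<open>L\<close> is a single entry
  joined by \<open>One\<close>; then that entry prolongs the first layer of s(R). Hence the length
  depends on the tree alone, which later allows the maximum of \<open>L\<close> to be located among
  the values of \<open>R\<close>.\<close>

lemma head_rank_encodes:
  assumes "encodes t p"
  shows "card {y \<in> set p. y \<le> hd (stack_sort p)} = head_rank t"
  using assms
proof (induction t arbitrary: p)
  case Leaf
  then obtain m where "p = [m]"
    by auto
  moreover have "{y. y = m \<and> y \<le> m} = {m}"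
    by auto
  ultimately show ?case
    using stack_sort_snoc[of "[]" m] by simp
next
  case (Left_Only l)
  then obtain L m where p: "p = L @ [m]" "\<forall>x\<in>set L. x < m" "encodes l L"
    by auto
  then have L: "distinct L" "L \<noteq> []"
    using encodes_properties by blast+
  then have "hd (stack_sort L) \<in> set L" "hd (stack_sort p) = hd (stack_sort L)"
    using p hd_stack_sort_in by (auto simp: stack_sort_snoc stack_sort_eq_Nil_iff)
  then have "{y \<in> set p. y \<le> hd (stack_sort p)} = {y \<in> set L. y \<le> hd (stack_sort L)}"
    using p by force
  then show ?case
    using Left_Only.IH p by simp
next
  case (Right_Only r)
  then obtain R m where p: "p = m # R" "\<forall>x\<in>set R. x < m" "encodes r R"
    by auto
  then have R: "distinct R" "R \<noteq> []"
    using encodes_properties by blast+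
  then have "hd (stack_sort R) \<in> set R" "hd (stack_sort p) = hd (stack_sort R)"
    using p hd_stack_sort_in by (auto simp: stack_sort_Cons stack_sort_eq_Nil_iff)
  then have "{y \<in> set p. y \<le> hd (stack_sort p)} = {y \<in> set R. y \<le> hd (stack_sort R)}"
    using p by force
  then show ?case
    using Right_Only.IH p by simp
next
  case (Both c l r)
  then obtain L m R where p: "p = L @ m # R" "\<forall>x\<in>set L \<union> set R. x < m"
    "encodes l L" "encodes r R" "joins c L R"
    by auto
  have L: "distinct L" "L \<noteq> []" and R: "distinct R" "R \<noteq> []" and d: "distinct p"
    using encodes_properties p Both.prems by blast+
  have "stack_sort p = stack_sort L @ stack_sort R @ [m]"
    using p d stack_sort_max_split[of L m R] by blast
  then have hd: "hd (stack_sort p) = hd (stack_sort L)"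
    using L by (simp add: stack_sort_eq_Nil_iff)
  have hL: "hd (stack_sort L) \<in> set L"
    using L hd_stack_sort_in by blast
  show ?case
  proof (cases "c = One \<and> l = Leaf")
    case True
    then obtain a where a: "L = [a]"
      using p by auto
    then have "hd (stack_sort L) = a"
      using hL by simp
    \<comment> \<open>By \<open>joins One\<close>, the entries of \<open>R\<close> below
      \<open>a\<close> are those up to the head of s(R), and \<open>a\<close> itself adds
      one.\<close>
    then have "{y \<in> set p. y \<le> hd (stack_sort p)} =
        insert a {y \<in> set R. y \<le> hd (stack_sort R)}" "a \<notin> set R"
      using p True hd a by auto
    then show ?thesis
      using Both.IH(2) p True by simp
  next
    case False
    have "\<forall>y\<in>set R. hd (stack_sort L) < y"
    proof (cases c)
      case Zero
      then show ?thesis using p(5) hL by simp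
    next
      case One
      obtain u where u: "stack_sort L = u @ [Max (set L)]" "set u = set L - {Max (set L)}"
        using stack_sort_last_Max[OF L] by metis
      have "u \<noteq> []"
      proof
        assume "u = []"
        then have "set L = {Max (set L)}"
          using L u by auto
        then have "card (set L) = 1"
          by (metis is_singletonI is_singleton_altdef)
        then have "vertices l = 1"
          using encodes_properties[OF p(3)] distinct_card[OF L(1)] by simp
        then show False
          using False One by (cases l) auto
      qed
      \<comment> \<open>With at least two entries in \<open>L\<close>, s(L) does not start with its
        maximum, and \<open>One\<close> moves only the maximum above entries of
        \<open>R\<close>.\<close>
      then have "hd (stack_sort L) \<in> set L - {Max (set L)}"
        using u by (metis hd_append2 hd_in_set)
      then show ?thesis
        using One p(5) by auto
    qed
    then have "\<not> y \<le> hd (stack_sort L)" if "y \<in> insert m (set R)" for y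
      using that p(2) hL by (auto simp: not_le)
    then have "{y \<in> set p. y \<le> hd (stack_sort p)} = {y \<in> set L. y \<le> hd (stack_sort L)}"
      unfolding hd by (auto simp: p(1))
    then show ?thesis
      using Both.IH(1) p False by auto
  qed
qed

section \<open>A tree and a set of values determine the word\<close>

text \<open>Two initial segments of a linear order are comparable by inclusion, so equal size forces
  equality.\<close>

lemma initial_segment_unique:
  fixes B :: "'a :: linorder set"
  assumes "finite B" "D \<subseteq> B" "D' \<subseteq> B" "card D = card D'"
    and "\<forall>x\<in>D. \<forall>y\<in>B - D. x < y" "\<forall>x\<in>D'. \<forall>y\<in>B - D'. x < y"
  shows "D = D'"
proof -
  have fin: "finite D" "finite D'"
    using assms finite_subset by blast+
  have "D \<subseteq> D' \<or> D' \<subseteq> D"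
    using assms(2,3,5,6) by (meson DiffI in_mono order.asym subsetI)
  then show ?thesis
    using card_subset_eq fin assms(4) by metis
qed

lemma ex_initial_segment:
  fixes B :: "'a :: linorder set"
  assumes "finite B" "k \<le> card B"
  obtains D where "D \<subseteq> B" "card D = k" "\<forall>x\<in>D. \<forall>y\<in>B - D. x < y"
proof -
  have "\<exists>D\<subseteq>B. card D = k \<and> (\<forall>x\<in>D. \<forall>y\<in>B - D. x < y)"
    using assms(2)
  proof (induction k)
    case 0
    show ?case by (rule exI[of _ "{}"]) simp
  next
    case (Suc k)
    then obtain D where D: "D \<subseteq> B" "card D = k" "\<forall>x\<in>D. \<forall>y\<in>B - D. x < y"
      by auto
    have fin: "finite D" "finite (B - D)"
      using D(1) assms(1) finite_subset by auto
    have "B - D \<noteq> {}"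
      using D Suc.prems by (metis Diff_eq_empty_iff Suc_n_not_le_n subset_antisym)
    then have m: "Min (B - D) \<in> B - D" "\<forall>y\<in>B - D. Min (B - D) \<le> y"
      using fin Min_in[of "B - D"] by simp_all
    show ?case
    proof (intro exI conjI)
      show "insert (Min (B - D)) D \<subseteq> B" "card (insert (Min (B - D)) D) = Suc k"
        using m D fin by auto
      show "\<forall>x\<in>insert (Min (B - D)) D. \<forall>y\<in>B - insert (Min (B - D)) D. x < y"
        using m D(3) by (auto simp: less_le)
    qed
  qed
  then show thesis
    using that by blast
qed

text \<open>Under \<open>Zero\<close>, the values of \<open>L\<close> are an initial segment of
  known size. Under \<open>One\<close>, this is true of \<open>L\<close> without its maximum
  \<open>a\<close>, and among the remaining values \<open>a\<close> is located by the number of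
  those below it, which is the length of the first layer of s(R).\<close>

lemma joins_sets_unique:
  assumes "joins c L R" "joins c L' R'" "L \<noteq> []" "L' \<noteq> []"
    and union: "set L \<union> set R = set L' \<union> set R'"
    and card: "card (set L) = card (set L')"
    and rank: "card {y \<in> set R. y \<le> hd (stack_sort R)} = card {y \<in> set R'. y \<le> hd (stack_sort R')}"
  shows "set L = set L' \<and> set R = set R'"
proof (cases c)
  case Zero
  have "set L = set L'"
    by (rule initial_segment_unique[of "set L \<union> set R"])
       (use assms Zero in \<open>auto simp flip: union\<close>, use union in auto)
  then show ?thesis
    using union joins_disjoint[OF assms(1)] joins_disjoint[OF assms(2)] by blast
next
  case One
  define a a' where "a = Max (set L)" and "a' = Max (set L')"
  have a: "a \<in> set L" "\<forall>x\<in>set L. x \<le> a" and a': "a' \<in> set L'" "\<forall>x\<in>set L'. x \<le> a'"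
    using assms(3,4) by (simp_all add: a_def a'_def)
  have j: "a \<notin> set R" "\<forall>x\<in>set L - {a}. \<forall>y\<in>set R. x < y"
      "\<forall>y\<in>set R. y < a \<longleftrightarrow> y \<le> hd (stack_sort R)"
    and j': "a' \<notin> set R'" "\<forall>x\<in>set L' - {a'}. \<forall>y\<in>set R'. x < y"
      "\<forall>y\<in>set R'. y < a' \<longleftrightarrow> y \<le> hd (stack_sort R')"
    using assms(1,2) One by (simp_all add: a_def a'_def)
  define B where "B = set L \<union> set R"
  have B': "B = set L' \<union> set R'"
    using union by (simp add: B_def)
  have D: "set L - {a} = set L' - {a'}"
  proof (rule initial_segment_unique[of B])
    show "card (set L - {a}) = card (set L' - {a'})"
      using a a' card by simp
    show "\<forall>x\<in>set L - {a}. \<forall>y\<in>B - (set L - {a}). x < y"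
      using a j unfolding B_def by force
    show "\<forall>x\<in>set L' - {a'}. \<forall>y\<in>B - (set L' - {a'}). x < y"
      using a' j' unfolding B' by force
    show "set L - {a} \<subseteq> B"
      by (auto simp: B_def)
    show "set L' - {a'} \<subseteq> B"
      by (auto simp: B')
  qed (simp add: B_def)
  define E where "E = insert a (set R)"
  have "set L \<inter> set R = {}" "set L' \<inter> set R' = {}"
    using assms joins_disjoint by blast+
  then have E: "E = B - (set L - {a})" "E = B - (set L' - {a'})"
    using a D by (auto simp: E_def B_def)
  then have E': "E = insert a' (set R')"
    using a' \<open>set L' \<inter> set R' = {}\<close> by (auto simp: B')
  \<comment> \<open>Both sets are initial segments of the common remainder \<open>E\<close>, and the
    rank hypothesis gives them equal size.\<close>
  have seg: "{y \<in> E. y < a} = {y \<in> E. y < a'}"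
  proof (rule initial_segment_unique[of E])
    have "{y \<in> E. y < a} = {y \<in> set R. y \<le> hd (stack_sort R)}"
      using j by (auto simp: E_def)
    moreover have "{y \<in> E. y < a'} = {y \<in> set R'. y \<le> hd (stack_sort R')}"
      using j' by (auto simp: E')
    ultimately show "card {y \<in> E. y < a} = card {y \<in> E. y < a'}"
      using rank by simp
  qed (auto simp: E_def)
  have "a \<in> E" "a' \<in> E"
    by (simp add: E_def, simp add: E')
  then have "a = a'"
    using seg by (metis (mono_tags, lifting) less_irrefl linorder_neqE_nat mem_Collect_eq)
  moreover have "set L = insert a (set L - {a})" "set L' = insert a' (set L' - {a'})"
    using a a' by blast+
  moreover have "set R = E - {a}" "set R' = E - {a'}"
    using j(1) j'(1) by (simp add: E_def, simp add: E')
  ultimately show ?thesis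
    using D by metis
qed

text \<open>The tree fixes the lengths of both parts and, through \<open>head_rank\<close>, the
  first layer of s(R); so the values split in the same way for both words and the induction applies
  to each part.\<close>

lemma encodes_word_unique:
  assumes "encodes t p" "encodes t p'" "set p = set p'"
  shows "p = p'"
  using assms
proof (induction t arbitrary: p p')
  case Leaf
  then show ?case by auto
next
  case (Left_Only l)
  then obtain L m L' m' where p: "p = L @ [m]" "\<forall>x\<in>set L. x < m" "encodes l L"
    and p': "p' = L' @ [m']" "\<forall>x\<in>set L'. x < m'" "encodes l L'"
    by auto
  have "insert m (set L) = insert m' (set L')"
    using Left_Only.prems(3) p p' by simp
  from insert_greatest_eq[OF this p(2) p'(2)] have "m = m'" "set L = set L'" .
  then show ?case
    using Left_Only.IH p p' by blast
next
  case (Right_Only r)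
  then obtain R m R' m' where p: "p = m # R" "\<forall>x\<in>set R. x < m" "encodes r R"
    and p': "p' = m' # R'" "\<forall>x\<in>set R'. x < m'" "encodes r R'"
    by auto
  have "insert m (set R) = insert m' (set R')"
    using Right_Only.prems(3) p p' by simp
  from insert_greatest_eq[OF this p(2) p'(2)] have "m = m'" "set R = set R'" .
  then show ?case
    using Right_Only.IH p p' by blast
next
  case (Both c l r)
  then obtain L m R L' m' R' where p: "p = L @ m # R" "\<forall>x\<in>set L \<union> set R. x < m"
      "encodes l L" "encodes r R" "joins c L R"
    and p': "p' = L' @ m' # R'" "\<forall>x\<in>set L' \<union> set R'. x < m'"
      "encodes l L'" "encodes r R'" "joins c L' R'"
    by auto
  have "insert m (set L \<union> set R) = insert m' (set L' \<union> set R')"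
    using Both.prems(3) p p' by simp
  note m = insert_greatest_eq(1)[OF this p(2) p'(2)]
    and un = insert_greatest_eq(2)[OF this p(2) p'(2)]
  have "card (set L) = card (set L')" "L \<noteq> []" "L' \<noteq> []"
    using encodes_properties p p' distinct_card by metis+
  then have "set L = set L' \<and> set R = set R'"
    using joins_sets_unique[OF p(5) p'(5)] un head_rank_encodes p p' by metis
  then show ?case
    using Both.IH p p' m by metis
qed

section \<open>Every tree encodes a word on any set of values of the right size\<close>

text \<open>Ensures that after \<open>head_rank r\<close> of the \<open>vertices r + 1\<close>
  remaining values are set aside, one is left to become the maximum of \<open>L\<close> under
  \<open>One\<close>.\<close>

lemma head_rank_le_vertices: "head_rank t \<le> vertices t"
  by (induction t) auto

text \<open>Runs the reconstruction in \<open>joins_sets_unique\<close> forwards. Under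
  \<open>One\<close> the maximum of \<open>L\<close> has to be chosen before \<open>R\<close>
  exists, which is possible because \<open>head_rank r\<close> is already known from the
  tree.\<close>

lemma ex_word_encodes:
  assumes "finite A" "card A = vertices t"
  shows "\<exists>p. encodes t p \<and> set p = A"
  using assms
proof (induction t arbitrary: A)
  case Leaf
  then obtain m where "A = {m}"
    by (auto simp: card_1_singleton_iff)
  then show ?case
    by (intro exI[of _ "[m]"]) auto
next
  case (Left_Only l)
  have A: "A \<noteq> {}"
    using Left_Only.prems by auto
  then have m: "Max A \<in> A" "\<forall>x\<in>A - {Max A}. x < Max A"
    using Left_Only.prems by (auto simp: less_le)
  then obtain L where "encodes l L" "set L = A - {Max A}"
    using Left_Only.IH[of "A - {Max A}"] Left_Only.prems by auto
  then show ?case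
    using m by (intro exI[of _ "L @ [Max A]"]) auto
next
  case (Right_Only r)
  have A: "A \<noteq> {}"
    using Right_Only.prems by auto
  then have m: "Max A \<in> A" "\<forall>x\<in>A - {Max A}. x < Max A"
    using Right_Only.prems by (auto simp: less_le)
  then obtain R where "encodes r R" "set R = A - {Max A}"
    using Right_Only.IH[of "A - {Max A}"] Right_Only.prems by auto
  then show ?case
    using m by (intro exI[of _ "Max A # R"]) auto
next
  case (Both c l r)
  define B where "B = A - {Max A}"
  have A: "A \<noteq> {}"
    using Both.prems by auto
  then have m: "Max A \<in> A" "\<forall>x\<in>B. x < Max A"
    using Both.prems by (auto simp: less_le B_def)
  have B: "finite B" "card B = vertices l + vertices r" "A = insert (Max A) B"
    using m Both.prems by (auto simp: B_def)
  have "\<exists>L R. encodes l L \<and> encodes r R \<and> joins c L R \<and> set L \<union> set R = B"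
  proof (cases c)
    case Zero
    obtain D where D: "D \<subseteq> B" "card D = vertices l" "\<forall>x\<in>D. \<forall>y\<in>B - D. x < y"
      using ex_initial_segment[OF B(1), of "vertices l"] B(2) by auto
    then have "finite D"
      using B(1) finite_subset by blast
    then have "card (B - D) = vertices r"
      using B(2) D by (simp add: card_Diff_subset)
    then obtain L R where "encodes l L" "set L = D" "encodes r R" "set R = B - D"
      using Both.IH(1)[of D] Both.IH(2)[of "B - D"] \<open>finite D\<close> D B(1) by auto
    then show ?thesis
      using Zero D by (intro exI[of _ L] exI[of _ R]) auto
  next
    case One
    \<comment> \<open>One place in \<open>L\<close> is kept free for its maximum \<open>a\<close>,
      chosen below.\<close>
    have "vertices l - 1 \<le> card B"
      using B(2) by simp
    then obtain D where D: "D \<subseteq> B" "card D = vertices l - 1" "\<forall>x\<in>D. \<forall>y\<in>B - D. x < y"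
      using ex_initial_segment[OF B(1)] by blast
    define E where "E = B - D"
    have finD: "finite D"
      using D(1) B(1) finite_subset by blast
    have E: "finite E" "card E = Suc (vertices r)"
      using D B finD vertices_pos[of l] by (auto simp: card_Diff_subset E_def)
    \<comment> \<open>\<open>F\<close> is the set of values intended for the first layer of s(R),
      and \<open>a\<close> will be the next larger value of \<open>E\<close>.\<close>
    obtain F where F: "F \<subseteq> E" "card F = head_rank r" "\<forall>x\<in>F. \<forall>y\<in>E - F. x < y"
      using ex_initial_segment[OF E(1), of "head_rank r"] E(2) head_rank_le_vertices[of r] by auto
    have finF: "finite F"
      using F(1) E(1) finite_subset by blast
    define a where "a = Min (E - F)"
    have "E - F \<noteq> {}"
      using F E head_rank_le_vertices[of r] finF by (metis card_mono Diff_eq_empty_iff not_less_eq_eq)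
    then have a: "a \<in> E" "a \<notin> F" "\<forall>y\<in>E - F. a \<le> y"
      using E(1) Min_in[of "E - F"] by (simp_all add: a_def)
    have "y \<in> F \<longleftrightarrow> y < a" if "y \<in> E" for y
      using a F(3) that by (meson DiffI linorder_not_le)
    then have lt_a: "F = {y \<in> E - {a}. y < a}"
      using F(1) by auto
    have "a \<notin> D" "a \<in> B"
      using a by (auto simp: E_def)
    then have "card (insert a D) = vertices l" "card (E - {a}) = vertices r"
      using D E finD a vertices_pos[of l] by auto
    then obtain L R where L: "encodes l L" "set L = insert a D" and R: "encodes r R" "set R = E - {a}"
      using Both.IH(1)[of "insert a D"] Both.IH(2)[of "E - {a}"] finD E by auto
    have max: "Max (set L) = a"
      using L(2) D(3) \<open>a \<notin> D\<close> \<open>a \<in> B\<close> finD by (intro Max_eqI) (auto intro: less_imp_le)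
    \<comment> \<open>Whatever word \<open>R\<close> the induction hypothesis returns, its first
      layer has the planned size, and as an initial segment of the same values it must be
      \<open>F\<close>.\<close>
    have "{y \<in> set R. y \<le> hd (stack_sort R)} = F"
    proof (rule initial_segment_unique[of "set R"])
      show "card {y \<in> set R. y \<le> hd (stack_sort R)} = card F"
        using head_rank_encodes[OF R(1)] F(2) by simp
      show "F \<subseteq> set R"
        using F(1) a(2) R(2) by blast
      show "\<forall>x\<in>F. \<forall>y\<in>set R - F. x < y"
        using F(3) R(2) by blast
    qed auto
    then have "\<forall>y\<in>set R. y < a \<longleftrightarrow> y \<le> hd (stack_sort R)"
      using lt_a R(2) by auto
    then have "joins c L R"
      using One max L R D by (auto simp: E_def)
    then show ?thesis
      using L R D \<open>a \<in> B\<close> \<open>a \<notin> D\<close> by (intro exI[of _ L] exI[of _ R]) (auto simp: E_def)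
  qed
  then obtain L R where "encodes l L" "encodes r R" "joins c L R" "set L \<union> set R = B"
    by blast
  then show ?case
    using m B by (intro exI[of _ "L @ Max A # R"]) auto
qed

section \<open>The bijection between preimages and trees\<close>

theorem proposition2p1:
  fixes n k :: nat
  assumes "n \<ge> 1" and "k \<ge> 1"
  shows "card {p \<in> stack_sort_preimage n (Av n [2, 3, 1] [3, 1, 2]). descents p = k - 1} = BoNa n k"
proof -
  define S where "S = {p \<in> stack_sort_preimage n (Av n [2, 3, 1] [3, 1, 2]). descents p = k - 1}"
  let ?T = "{t. vertices t = n \<and> right_edges t = k - 1}"
  \<comment> \<open>Membership in \<open>Av\<close> also asks that s(p) be a permutation of the same
    set, which is automatic as sorting preserves entries and distinctness.\<close>
  have P: "p \<in> S \<longleftrightarrow> set p = {1..n} \<and> distinct p \<and> layered (stack_sort p) \<and> descents p = k - 1" for p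
    using set_distinct_stack_sort[of p]
    unfolding S_def stack_sort_preimage_def Av_def permutations_of_set_def layered_iff_avoids mem_Collect_eq
    by metis
  have "\<forall>p\<in>S. \<exists>t. encodes t p"
  proof
    fix p assume "p \<in> S"
    then have p: "set p = {1..n}" "distinct p" "layered (stack_sort p)"
      using P by blast+
    \<comment> \<open>The hypothesis \<open>n \<ge> 1\<close> enters here: every tree has a vertex,
      so the empty word has no code.\<close>
    then have "p \<noteq> []"
      using assms(1) by auto
    then show "\<exists>t. encodes t p"
      using p ex_encodes by blast
  qed
  then obtain f where f: "\<forall>p\<in>S. encodes (f p) p"
    by metis
  have "bij_betw f S ?T"
    unfolding bij_betw_def
  proof
    show "inj_on f S"
    proof (rule inj_onI)
      fix p p' assume pp': "p \<in> S" "p' \<in> S" "f p = f p'"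
      have "encodes (f p) p" "encodes (f p) p'"
        using bspec[OF f pp'(1)] bspec[OF f pp'(2)] pp'(3) by simp_all
      moreover have "set p = set p'"
        using P[of p] P[of p'] pp'(1,2) by argo
      ultimately show "p = p'"
        by (rule encodes_word_unique)
    qed
    show "f ` S = ?T"
    proof
      show "f ` S \<subseteq> ?T"
      proof
        fix t assume "t \<in> f ` S"
        then obtain p where p: "p \<in> S" "encodes t p"
          using f by blast
        then have "length p = n"
          using P distinct_card[of p] by simp
        then show "t \<in> ?T"
          using p P encodes_properties[OF p(2)] by simp
      qed
      show "?T \<subseteq> f ` S"
      proof
        fix t assume t: "t \<in> ?T"
        then obtain p where p: "encodes t p" "set p = {1..n}"
          using ex_word_encodes[of "{1..n}" t] by auto
        then have "p \<in> S"
          using P t encodes_properties[OF p(1)] by simp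
        \<comment> \<open>\<open>f\<close> was obtained by choice; uniqueness of the tree shows that
          it can only have chosen \<open>t\<close>.\<close>
        moreover have "f p = t"
          using encodes_tree_unique f p \<open>p \<in> S\<close> P by blast
        ultimately show "t \<in> f ` S"
          by blast
      qed
    qed
  qed
  then show ?thesis
    unfolding BoNa_def S_def by (rule bij_betw_same_card)
qed

end
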